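(* Let $r>0$, $\theta\in[0,1]$, let $A=\begin{pmatrix}\cos 2\pi\theta&-\sin 2\pi\theta\\\sin 2\pi\theta&\cos 2\pi\theta\end{pmatrix}\begin{pmatrix}r&0\\0&r\end{pmatrix}$, and let $T:\mathbb{R}^2\to\mathbb{R}^2$, $Tx=Ax$. If $\theta$ is rational with $\theta\notin\{0,0.5,1\}$ and $r=1$, then $T$ is strongly Devaney chaotic in weak topology. Otherwise, $T$ is not weakly Devaney chaotic in weak topology.
   Context: Let $\mathbb{N}=\{1,2,3,\dots\}$. Continuous linear functionals on $\mathbb{R}^2$ are identified with vectors $x^*\in\mathbb{R}^2$ via $\langle x,x^*\rangle=x_1x_1^*+x_2x_2^*$, and $p_{x^*}(x)=|\langle x,x^*\rangle|$. A point $x$ is periodic for $T$ if $T^kx=x$ for some $k\in\mathbb{N}$. $T$ is weakly (resp. strongly) transitive in weak topology if for some nonzero $x^*$ (resp. every nonzero $x^*$): for all $x,y\in\mathbb{R}^2$ and $\varepsilon>0$ there exist $n\in\mathbb{N}$, $z\in\mathbb{R}^2$ with $p_{x^*}(z-x)<\varepsilon$ and $p_{x^*}(T^nz-y)<\varepsilon$. $T$ has weakly (resp. strongly) dense periodic points in weak topology if for some nonzero $x^*$ (resp. every nonzero $x^*$): for every $x\in\mathbb{R}^2$ and $\varepsilon>0$ there is a periodic point $y$ with $p_{x^*}(x-y)<\varepsilon$. $T$ is strongly sensitive in weak topology if there is $\delta>0$ such that for every nonzero $x^*$, every $x_0\in\mathbb{R}^2$ and every $\varepsilon>0$ there exist $x,y\in\mathbb{R}^2$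 and $n\in\mathbb{N}$ with $p_{x^*}(x-x_0)<\varepsilon$, $p_{x^*}(y-x_0)<\varepsilon$ and $p_{x^*}(T^nx-T^ny)>\delta$. $T$ is weakly sensitive in weak topology if there are $\delta>0$ and a nonzero $x^*$ such that for every $x_0\in\mathbb{R}^2$ and $\varepsilon>0$ there exist such $x,y,n$ (same three inequalities). $T$ is weakly Devaney chaotic in weak topology if it is weakly transitive, has weakly dense periodic points, and is weakly sensitive, all in weak topology (the functionals $x^*$ may differ between the three properties). $T$ is strongly Devaney chaotic in weak topology if it is strongly transitive, has strongly dense periodic points, and is strongly sensitive, all in weak topology. *)

theory Defs
  imports "HOL-Analysis.Analysis"
begin

(* Continuous linear functionals on the plane are identified with vectors via the inner product.
   Iterate counts and periods are positive, hence the guards 1 \<le> n and 1 \<le> k below. *)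

definition wseminorm :: "real^2 \<Rightarrow> real^2 \<Rightarrow> real" where
  "wseminorm xs x = \<bar>x \<bullet> xs\<bar>"

definition periodic_point :: "(real^2 \<Rightarrow> real^2) \<Rightarrow> real^2 \<Rightarrow> bool" where
  "periodic_point T x \<longleftrightarrow> (\<exists>k::nat. 1 \<le> k \<and> (T ^^ k) x = x)"

definition transitive_wrt :: "(real^2 \<Rightarrow> real^2) \<Rightarrow> real^2 \<Rightarrow> bool" where
  "transitive_wrt T xs \<longleftrightarrow>
     (\<forall>x y. \<forall>\<epsilon>>0. \<exists>n::nat. \<exists>z. 1 \<le> n \<and>
        wseminorm xs (z - x) < \<epsilon> \<and> wseminorm xs ((T ^^ n) z - y) < \<epsilon>)"

definition weakly_transitive :: "(real^2 \<Rightarrow> real^2) \<Rightarrow> bool" where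
  "weakly_transitive T \<longleftrightarrow> (\<exists>xs. xs \<noteq> 0 \<and> transitive_wrt T xs)"

definition strongly_transitive :: "(real^2 \<Rightarrow> real^2) \<Rightarrow> bool" where
  "strongly_transitive T \<longleftrightarrow> (\<forall>xs. xs \<noteq> 0 \<longrightarrow> transitive_wrt T xs)"

definition dense_periodic_wrt :: "(real^2 \<Rightarrow> real^2) \<Rightarrow> real^2 \<Rightarrow> bool" where
  "dense_periodic_wrt T xs \<longleftrightarrow>
     (\<forall>x. \<forall>\<epsilon>>0. \<exists>y. periodic_point T y \<and> wseminorm xs (x - y) < \<epsilon>)"

definition weakly_dense_periodic :: "(real^2 \<Rightarrow> real^2) \<Rightarrow> bool" where
  "weakly_dense_periodic T \<longleftrightarrow> (\<exists>xs. xs \<noteq> 0 \<and> dense_periodic_wrt T xs)"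

definition strongly_dense_periodic :: "(real^2 \<Rightarrow> real^2) \<Rightarrow> bool" where
  "strongly_dense_periodic T \<longleftrightarrow> (\<forall>xs. xs \<noteq> 0 \<longrightarrow> dense_periodic_wrt T xs)"

definition sensitive_wrt :: "(real^2 \<Rightarrow> real^2) \<Rightarrow> real \<Rightarrow> real^2 \<Rightarrow> bool" where
  "sensitive_wrt T \<delta> xs \<longleftrightarrow>
     (\<forall>x0. \<forall>\<epsilon>>0. \<exists>x y. \<exists>n::nat. 1 \<le> n \<and>
        wseminorm xs (x - x0) < \<epsilon> \<and> wseminorm xs (y - x0) < \<epsilon> \<and>
        wseminorm xs ((T ^^ n) x - (T ^^ n) y) > \<delta>)"

definition weakly_sensitive :: "(real^2 \<Rightarrow> real^2) \<Rightarrow> bool" where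
  "weakly_sensitive T \<longleftrightarrow> (\<exists>\<delta>>0. \<exists>xs. xs \<noteq> 0 \<and> sensitive_wrt T \<delta> xs)"

definition strongly_sensitive :: "(real^2 \<Rightarrow> real^2) \<Rightarrow> bool" where
  "strongly_sensitive T \<longleftrightarrow> (\<exists>\<delta>>0. \<forall>xs. xs \<noteq> 0 \<longrightarrow> sensitive_wrt T \<delta> xs)"

definition weakly_devaney_chaotic :: "(real^2 \<Rightarrow> real^2) \<Rightarrow> bool" where
  "weakly_devaney_chaotic T \<longleftrightarrow>
     weakly_transitive T \<and> weakly_dense_periodic T \<and> weakly_sensitive T"

definition strongly_devaney_chaotic :: "(real^2 \<Rightarrow> real^2) \<Rightarrow> bool" where
  "strongly_devaney_chaotic T \<longleftrightarrow>
     strongly_transitive T \<and> strongly_dense_periodic T \<and> strongly_sensitive T"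

definition plane_rotation :: "real \<Rightarrow> real^2^2" where
  "plane_rotation \<phi> = vector [vector [cos \<phi>, - sin \<phi>], vector [sin \<phi>, cos \<phi>]]"

definition scaling_matrix :: "real \<Rightarrow> real^2^2" where
  "scaling_matrix r = vector [vector [r, 0], vector [0, r]]"

end

theory Submission
  imports Defs
begin

text \<open>
  The map \<open>T\<close> is composed of the rotation by \<open>2\<pi>\<theta>\<close> and the homothety of ratio \<open>r\<close>. The two commute,
  so the \<open>n\<close>-th iterate is composed of the rotation by \<open>2\<pi>n\<theta>\<close> and the homothety of ratio \<open>r\<^sup>n\<close>
  (\<open>funpow_rotation_homothety\<close>).

  A single functional \<open>x\<^sup>*\<close> sees only one coordinate of the plane. If the rotation is not by a
  multiple of \<open>\<pi>\<close>, then \<open>x\<^sup>*\<close> and its pull-back \<open>x\<^sup>* \<circ> T\<close> are linearly independent, so the values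
  of \<open>x\<^sup>*\<close> at \<open>z\<close> and at \<open>T z\<close> can be prescribed independently
  (\<open>rotation_homothety_prescribed_values\<close>). This yields transitivity and sensitivity already with
  the first iterate. If moreover \<open>r = 1\<close> and \<open>\<theta>\<close> is rational, some iterate of \<open>T\<close> is the identity
  and every point is periodic.

  In the remaining cases one ingredient of weak chaos fails. A nonzero periodic point
  returns to its own norm and its own direction, which forces \<open>r = 1\<close> and \<open>\<theta>\<close> rational
  (\<open>rotation_homothety_nonzero_periodic\<close>); otherwise \<open>0\<close> is the only periodic point, and \<open>{0}\<close> is
  not dense for the seminorm of any nonzero functional. If \<open>r = 1\<close> and \<open>\<theta> \<in> {0, 1/2, 1}\<close>, then
  \<open>T\<close> is plus or minus the identity, which preserves the seminorm of every functional; points that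
  are close for it stay equally close, and sensitivity fails.
\<close>

section \<open>Consequences for chaos in the weak topology\<close>

lemma transitive_wrt_of_prescribed_values:
  assumes "\<And>a b. \<exists>z. z \<bullet> xs = a \<and> T z \<bullet> xs = b"
  shows "transitive_wrt T xs"
  unfolding transitive_wrt_def
proof (intro allI impI)
  fix x y :: "real^2" and \<epsilon> :: real
  assume "\<epsilon> > 0"
  moreover obtain z where "z \<bullet> xs = x \<bullet> xs" "T z \<bullet> xs = y \<bullet> xs"
    using assms by blast
  ultimately have "1 \<le> (1::nat) \<and> wseminorm xs (z - x) < \<epsilon> \<and> wseminorm xs ((T ^^ 1) z - y) < \<epsilon>"
    by (simp add: wseminorm_def inner_diff_left)
  then show "\<exists>n z. 1 \<le> n \<and> wseminorm xs (z - x) < \<epsilon> \<and> wseminorm xs ((T ^^ n) z - y) < \<epsilon>"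
    by blast
qed

text \<open>
  By linearity \<open>x\<^sub>0\<close> may be perturbed by a vector that \<open>x\<^sup>*\<close> annihilates but whose image it does not;
  the perturbation can be scaled freely, so any sensitivity constant is attained.
\<close>

lemma sensitive_wrt_of_prescribed_values:
  assumes "linear T" and "\<And>a b. \<exists>z. z \<bullet> xs = a \<and> T z \<bullet> xs = b"
  shows "sensitive_wrt T \<delta> xs"
  unfolding sensitive_wrt_def
proof (intro allI impI)
  fix x0 :: "real^2" and \<epsilon> :: real
  assume "\<epsilon> > 0"
  moreover obtain v where "v \<bullet> xs = 0" "T v \<bullet> xs = \<bar>\<delta>\<bar> + 1"
    using assms(2) by blast
  ultimately have "1 \<le> (1::nat) \<and> wseminorm xs ((x0 + v) - x0) < \<epsilon> \<and> wseminorm xs (x0 - x0) < \<epsilon>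
      \<and> wseminorm xs ((T ^^ 1) (x0 + v) - (T ^^ 1) x0) > \<delta>"
    by (simp add: wseminorm_def linear_add[OF assms(1)])
  then show "\<exists>x y n. 1 \<le> n \<and> wseminorm xs (x - x0) < \<epsilon> \<and> wseminorm xs (y - x0) < \<epsilon>
      \<and> wseminorm xs ((T ^^ n) x - (T ^^ n) y) > \<delta>"
    by blast
qed

lemma strongly_dense_periodic_of_all_periodic:
  assumes "\<And>x. periodic_point T x"
  shows "strongly_dense_periodic T"
  unfolding strongly_dense_periodic_def dense_periodic_wrt_def
proof (intro allI impI)
  fix xs x :: "real^2" and \<epsilon> :: real
  assume "\<epsilon> > 0"
  then show "\<exists>y. periodic_point T y \<and> wseminorm xs (x - y) < \<epsilon>"
    using assms by (intro exI[of _ x]) (simp add: wseminorm_def)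
qed

lemma weakly_dense_periodic_imp_nonzero_periodic:
  assumes "weakly_dense_periodic T"
  obtains y where "y \<noteq> 0" "periodic_point T y"
proof -
  obtain xs where "xs \<noteq> 0" and dense: "dense_periodic_wrt T xs"
    using assms by (auto simp: weakly_dense_periodic_def)
  then have "xs \<bullet> xs > 0" by simp
  \<comment> \<open>The point \<open>xs\<close> lies at seminorm distance exactly \<open>xs \<bullet> xs\<close> from the origin.\<close>
  then obtain y where "periodic_point T y" "wseminorm xs (xs - y) < xs \<bullet> xs"
    using dense unfolding dense_periodic_wrt_def by blast
  moreover from this have "y \<noteq> 0" by (auto simp: wseminorm_def)
  ultimately show thesis using that by blast
qed

lemma not_weakly_sensitive_of_wseminorm_preserving:
  assumes "linear T" and "\<And>xs v. wseminorm xs (T v) = wseminorm xs v"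
  shows "\<not> weakly_sensitive T"
proof
  assume "weakly_sensitive T"
  then obtain \<delta> xs where "\<delta> > 0" "sensitive_wrt T \<delta> xs"
    by (auto simp: weakly_sensitive_def)
  then obtain x y n where x: "wseminorm xs (x - 0) < \<delta> / 2" and y: "wseminorm xs (y - 0) < \<delta> / 2"
    and far: "wseminorm xs ((T ^^ n) x - (T ^^ n) y) > \<delta>"
    unfolding sensitive_wrt_def by (meson half_gt_zero)
  have "wseminorm xs ((T ^^ n) x - (T ^^ n) y) = wseminorm xs (x - y)"
    by (induction n) (simp_all add: linear_diff[OF assms(1), symmetric] assms(2))
  also have "\<dots> < \<delta>"
    using x y by (auto simp: wseminorm_def inner_diff_left)
  finally show False using far by simp
qed

section \<open>Rotations composed with homotheties\<close>

definition rotation_homothety :: "real \<Rightarrow> real \<Rightarrow> real^2 \<Rightarrow> real^2" where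
  "rotation_homothety r \<phi> x =
     vector [r * (cos \<phi> * x$1 - sin \<phi> * x$2), r * (sin \<phi> * x$1 + cos \<phi> * x$2)]"

lemma rotation_homothety_nth [simp]:
  "rotation_homothety r \<phi> x $ 1 = r * (cos \<phi> * x$1 - sin \<phi> * x$2)"
  "rotation_homothety r \<phi> x $ 2 = r * (sin \<phi> * x$1 + cos \<phi> * x$2)"
  by (simp_all add: rotation_homothety_def)

lemma plane_rotation_scaling_mult_vec:
  "(plane_rotation \<phi> ** scaling_matrix r) *v x = rotation_homothety r \<phi> x"
  by (simp add: vec_eq_iff forall_2 matrix_vector_mult_def matrix_matrix_mult_def sum_2
      plane_rotation_def scaling_matrix_def algebra_simps)

lemma linear_rotation_homothety: "linear (rotation_homothety r \<phi>)"
  by (rule linearI) (simp_all add: vec_eq_iff forall_2 algebra_simps)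

lemma funpow_rotation_homothety:
  "(rotation_homothety r \<phi> ^^ n) x = rotation_homothety (r ^ n) (real n * \<phi>) x"
proof (induction n)
  case 0
  show ?case by (simp add: vec_eq_iff forall_2)
next
  case (Suc n)
  then have "(rotation_homothety r \<phi> ^^ Suc n) x
      = rotation_homothety r \<phi> (rotation_homothety (r ^ n) (real n * \<phi>) x)"
    by simp
  also have "\<dots> = rotation_homothety (r ^ Suc n) (\<phi> + real n * \<phi>) x"
    by (simp add: vec_eq_iff forall_2 cos_add sin_add algebra_simps)
  finally show ?case by (simp add: distrib_right)
qed

lemma inner_rotation_homothety_self: "rotation_homothety r \<phi> x \<bullet> x = r * cos \<phi> * (x \<bullet> x)"
  by (simp add: inner_vec_def sum_2 algebra_simps)

lemma norm_rotation_homothety: "norm (rotation_homothety r \<phi> x) = \<bar>r\<bar> * norm x"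
proof -
  have "rotation_homothety r \<phi> x \<bullet> rotation_homothety r \<phi> x
      = r\<^sup>2 * ((sin \<phi>)\<^sup>2 + (cos \<phi>)\<^sup>2) * (x \<bullet> x)"
    by (simp only: inner_vec_def sum_2 rotation_homothety_nth inner_real_def power2_eq_square)
      algebra
  then show ?thesis by (simp add: norm_eq_sqrt_inner real_sqrt_mult)
qed

text \<open>
  In the orthogonal basis formed by \<open>x\<^sup>*\<close> and its quarter turn \<open>J x\<^sup>*\<close>, the first coordinate of \<open>z\<close>
  fixes \<open>\<langle>z, x\<^sup>*\<rangle>\<close>; the second enters the value of \<open>x\<^sup>*\<close> at the image of \<open>z\<close> with coefficient
  \<open>-r \<bar>x\<^sup>*\<bar>\<^sup>2 sin \<phi>\<close>, so it can be solved for as soon as this does not vanish.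
\<close>

lemma rotation_homothety_prescribed_values:
  assumes "r \<noteq> 0" "sin \<phi> \<noteq> 0" "xs \<noteq> 0"
  shows "\<exists>z. z \<bullet> xs = a \<and> rotation_homothety r \<phi> z \<bullet> xs = b"
proof -
  define N where "N = xs \<bullet> xs"
  have N: "N \<noteq> 0" "N = xs$1 * xs$1 + xs$2 * xs$2"
    using assms(3) by (simp add: N_def) (simp add: N_def inner_vec_def sum_2)
  define J :: "real^2" where "J = vector [- xs$2, xs$1]"
  define \<beta> where "\<beta> = (a * cos \<phi> - b / r) / (N * sin \<phi>)"
  define z where "z = (a / N) *\<^sub>R xs + \<beta> *\<^sub>R J"
  have J: "J \<bullet> xs = 0" "rotation_homothety r \<phi> J \<bullet> xs = - r * sin \<phi> * N"
    by (simp_all add: J_def N(2) inner_vec_def sum_2 algebra_simps)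
  have "z \<bullet> xs = a"
    using J(1) N(1) by (simp add: z_def inner_add_left N_def)
  moreover have "rotation_homothety r \<phi> z \<bullet> xs = (a / N) * (r * cos \<phi> * N) - \<beta> * (r * sin \<phi> * N)"
    using J(2)
    by (simp add: z_def linear_add[OF linear_rotation_homothety]
        linear_scale[OF linear_rotation_homothety] inner_add_left inner_rotation_homothety_self N_def)
  moreover have "\<dots> = b"
    using N(1) assms(1,2) by (simp add: \<beta>_def field_simps)
  ultimately show ?thesis by auto
qed

text \<open>
  Comparing norms along a closed orbit gives \<open>r\<^sup>k = 1\<close>; comparing directions shows that the total
  angle \<open>2\<pi>k\<theta>\<close> is a whole number of turns.
\<close>

lemma rotation_homothety_nonzero_periodic:
  assumes "r > 0" "x \<noteq> 0" "periodic_point (rotation_homothety r (2 * pi * \<theta>)) x"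
  shows "r = 1" "\<theta> \<in> \<rat>"
proof -
  obtain k :: nat where k: "1 \<le> k"
    and closed: "rotation_homothety (r ^ k) (real k * (2 * pi * \<theta>)) x = x"
    using assms(3) by (auto simp: periodic_point_def funpow_rotation_homothety)
  have "r ^ k * norm x = norm x"
    using norm_rotation_homothety[of "r ^ k" "real k * (2 * pi * \<theta>)" x] assms(1) closed by simp
  then have rk: "r ^ k = 1" using assms(2) by simp
  then show "r = 1" using k assms(1) power_eq_imp_eq_base[of r k 1] by simp
  have "cos (real k * (2 * pi * \<theta>)) = 1"
    using inner_rotation_homothety_self[of "r ^ k" "real k * (2 * pi * \<theta>)" x] closed rk assms(2)
    by simp
  then obtain m :: int where "real k * (2 * pi * \<theta>) = of_int m * 2 * pi"
    by (auto simp: cos_one_2pi_int)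
  then have "\<theta> = of_int m / of_nat k" using k by (simp add: field_simps)
  then show "\<theta> \<in> \<rat>" by simp
qed

lemma rotation_periodic_of_rational:
  assumes "\<theta> \<in> \<rat>"
  shows "periodic_point (rotation_homothety 1 (2 * pi * \<theta>)) x"
proof -
  obtain m k :: int where "k > 0" and \<theta>: "\<theta> = of_int m / of_int k"
    using assms by (auto elim: Rats_cases')
  then have turns: "real (nat k) * (2 * pi * \<theta>) = 2 * pi * of_int m" by simp
  have "rotation_homothety (1 ^ nat k) (real (nat k) * (2 * pi * \<theta>)) x = x"
    unfolding turns by (simp add: vec_eq_iff forall_2)
  with \<open>k > 0\<close> show ?thesis
    unfolding periodic_point_def funpow_rotation_homothety
    by (intro exI[of _ "nat k"]) auto
qed

section \<open>The dichotomy\<close>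

lemma rational_rotation_strongly_devaney_chaotic:
  assumes "\<theta> \<in> \<rat>" and "sin (2 * pi * \<theta>) \<noteq> 0"
  shows "strongly_devaney_chaotic (rotation_homothety 1 (2 * pi * \<theta>))"
    (is "strongly_devaney_chaotic ?T")
proof -
  have vals: "\<exists>z. z \<bullet> xs = a \<and> ?T z \<bullet> xs = b" if "xs \<noteq> 0" for xs a b
    using rotation_homothety_prescribed_values[OF _ assms(2) that] by simp
  have "strongly_transitive ?T"
    unfolding strongly_transitive_def using transitive_wrt_of_prescribed_values vals by blast
  moreover have "sensitive_wrt ?T 1 xs" if "xs \<noteq> 0" for xs
    by (rule sensitive_wrt_of_prescribed_values[OF linear_rotation_homothety vals[OF that]])
  then have "strongly_sensitive ?T"
    unfolding strongly_sensitive_def using zero_less_one by blast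
  moreover have "strongly_dense_periodic ?T"
    using strongly_dense_periodic_of_all_periodic rotation_periodic_of_rational[OF assms(1)] by blast
  ultimately show ?thesis by (simp add: strongly_devaney_chaotic_def)
qed

text \<open>When \<open>sin \<phi>\<close> vanishes, the rotation is plus or minus the identity.\<close>

lemma not_weakly_sensitive_rotation_sin_zero:
  assumes "sin \<phi> = 0"
  shows "\<not> weakly_sensitive (rotation_homothety 1 \<phi>)"
proof (rule not_weakly_sensitive_of_wseminorm_preserving[OF linear_rotation_homothety])
  fix xs v :: "real^2"
  have "rotation_homothety 1 \<phi> v = cos \<phi> *\<^sub>R v"
    using assms by (simp add: vec_eq_iff forall_2)
  moreover have "\<bar>cos \<phi>\<bar> = 1"
    using assms sin_zero_abs_cos_one by blast
  ultimately show "wseminorm xs (rotation_homothety 1 \<phi> v) = wseminorm xs v"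
    by (simp add: wseminorm_def abs_mult)
qed

lemma sin_2pi_eq_0_iff:
  assumes "0 \<le> \<theta>" "\<theta> \<le> 1"
  shows "sin (2 * pi * \<theta>) = 0 \<longleftrightarrow> \<theta> \<in> {0, 1/2, 1}"
proof
  assume "sin (2 * pi * \<theta>) = 0"
  then obtain i :: int where "2 * pi * \<theta> = of_int i * pi"
    by (auto simp: sin_zero_iff_int2)
  then have i: "\<theta> = of_int i / 2" by simp
  with assms have "i = 0 \<or> i = 1 \<or> i = 2" by auto
  with i show "\<theta> \<in> {0, 1/2, 1}" by auto
next
  assume "\<theta> \<in> {0, 1/2, 1}"
  then have "2 * pi * \<theta> = 0 \<or> 2 * pi * \<theta> = pi \<or> 2 * pi * \<theta> = 2 * pi" by auto
  then show "sin (2 * pi * \<theta>) = 0" by (elim disjE) (simp_all only: sin_zero sin_pi sin_two_pi)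
qed

theorem theorem6p3:
  fixes r \<theta> :: real and A :: "real^2^2" and T :: "real^2 \<Rightarrow> real^2"
  assumes "r > 0"
    and "0 \<le> \<theta>" and "\<theta> \<le> 1"
    and "A = plane_rotation (2 * pi * \<theta>) ** scaling_matrix r"
    and "\<And>x. T x = A *v x"
  shows "(\<theta> \<in> \<rat> \<and> \<theta> \<notin> {0, 1/2, 1} \<and> r = 1 \<longrightarrow> strongly_devaney_chaotic T) \<and>
         (\<not> (\<theta> \<in> \<rat> \<and> \<theta> \<notin> {0, 1/2, 1} \<and> r = 1) \<longrightarrow> \<not> weakly_devaney_chaotic T)"
proof -
  have T: "T = rotation_homothety r (2 * pi * \<theta>)"
    using assms(4,5) by (simp add: fun_eq_iff plane_rotation_scaling_mult_vec)
  have sin: "sin (2 * pi * \<theta>) = 0 \<longleftrightarrow> \<theta> \<in> {0, 1/2, 1}"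
    by (rule sin_2pi_eq_0_iff[OF assms(2,3)])
  show ?thesis
  proof (intro conjI impI notI)
    assume "\<theta> \<in> \<rat> \<and> \<theta> \<notin> {0, 1/2, 1} \<and> r = 1"
    then show "strongly_devaney_chaotic T"
      using rational_rotation_strongly_devaney_chaotic sin T by simp
  next
    assume non: "\<not> (\<theta> \<in> \<rat> \<and> \<theta> \<notin> {0, 1/2, 1} \<and> r = 1)" and "weakly_devaney_chaotic T"
    then have dense: "weakly_dense_periodic T" and sens: "weakly_sensitive T"
      by (simp_all add: weakly_devaney_chaotic_def)
    obtain y where "y \<noteq> 0" "periodic_point T y"
      using weakly_dense_periodic_imp_nonzero_periodic[OF dense] by blast
    then have "r = 1" "\<theta> \<in> \<rat>"
      using rotation_homothety_nonzero_periodic[OF assms(1)] T by auto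
    with non sin sens T show False
      using not_weakly_sensitive_rotation_sin_zero by auto
  qed
qed

end
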